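(* Let $s\ge 0$ be an integer and $n$ a positive integer, and let $t_m=\frac{m(m+1)}{2}$. Set $N^{even}_{r}=6\lfloor\sqrt{r+1}\rfloor-6$ and $N^{odd}_{r}=6\left\lfloor\frac{\sqrt{4r+5}-1}{2}\right\rfloor-3$ for integers $r\ge0$, and let $\mathbb{B}=\{m\in\mathbb{N}: m=k^2 \text{ or } m=k(k+1)\text{ for some integer } k\ge1\}$. Suppose that $n>N^{even}_{s+1}$ if $n$ is even and $n>N^{odd}_{s+1}$ if $n$ is odd. Then: (i) if $s+1\notin\mathbb{B}$, then \[\mathtt{g}(t_n,t_{n+1},t_{n+2};s+1)-\mathtt{g}(t_n,t_{n+1},t_{n+2};s)=\frac{6(n+1)(n+2)}{4};\] (ii) if $n$ is even and $s+1\in\mathbb{B}$, say $s+1=k^2$ or $s+1=k(k+1)$ with $k\ge1$, then \[\mathtt{g}(t_n,t_{n+1},t_{n+2};s+1)-\mathtt{g}(t_n,t_{n+1},t_{n+2};s)=\frac{(n-6k+6)(n+1)(n+2)}{4};\] (iii) if $n$ is odd and $s+1\in\mathbb{B}$, then \[\mathtt{g}(t_n,t_{n+1},t_{n+2};s+1)-\mathtt{g}(t_n,t_{n+1},t_{n+2};s)=\begin{cases}\frac{(n-6k+9)(n+1)(n+2)}{4},&\text{if } s+1=k^2,\\[2pt] \frac{(n-6k+3)(n+1)(n+2)}{4},&\text{if } s+1=k(k+1),\end{cases}\] where $k\ge1$ is the integer with $s+1=k^2$ or $s+1=k(k+1)$ respectively.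
   Context: For positive integers $a_1,\dots,a_k$ with $\gcd(a_1,\dots,a_k)=1$ and an integer $m\ge 0$, $\operatorname{d}(m;a_1,\dots,a_k)$ denotes the number of tuples of non-negative integers $(x_1,\dots,x_k)$ with $a_1x_1+\dots+a_kx_k=m$. For an integer $s\ge0$, $\mathtt{g}(a_1,\dots,a_k;s)=\max\{m\in\mathbb{Z}:\operatorname{d}(m;a_1,\dots,a_k)\le s\}$ (generalized Frobenius number). *)

theory Defs
  imports Complex_Main
begin

text \<open>
  The argument \<open>m\<close> ranges over the integers because \<open>gen_frobenius\<close> below is a maximum over
  \<open>\<int>\<close>; for negative \<open>m\<close> the value is \<open>0\<close>. The set of solutions is finite
  when all entries of \<open>as\<close> are positive.
\<close>

definition denumerant :: "int \<Rightarrow> nat list \<Rightarrow> nat" where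
  "denumerant m as =
     card {xs :: nat list. length xs = length as \<and> int (\<Sum>i<length as. as ! i * xs ! i) = m}"

text \<open>
  \<open>Max\<close> cannot be used here: the set contains all negative integers, so it is infinite.
  The greatest element exists when the entries of \<open>as\<close> are positive with greatest common
  divisor \<open>1\<close>, as is the case for three consecutive positive
  triangular numbers.
\<close>

definition gen_frobenius :: "nat list \<Rightarrow> nat \<Rightarrow> int" where
  "gen_frobenius as s = (GREATEST m :: int. denumerant m as \<le> s)"

definition triangular :: "nat \<Rightarrow> nat" where
  "triangular m = m * (m + 1) div 2"

definition N_even :: "nat \<Rightarrow> int" where
  "N_even r = 6 * \<lfloor>sqrt (real r + 1)\<rfloor> - 6"

definition N_odd :: "nat \<Rightarrow> int" where
  "N_odd r = 6 * \<lfloor>(sqrt (4 * real r + 5) - 1) / 2\<rfloor> - 3"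

definition BB :: "nat set" where
  "BB = {m. \<exists>k\<ge>1. m = k\<^sup>2 \<or> m = k * (k + 1)}"

abbreviation triangular_frobenius :: "nat \<Rightarrow> nat \<Rightarrow> int" where
  "triangular_frobenius n s \<equiv>
     gen_frobenius [triangular n, triangular (n + 1), triangular (n + 2)] s"

end

(*
  For n = 2h or n = 2h + 1 the three triangular numbers have the form B p, A B, A q with A prime
  to B and p, and B prime to q. Every integer is then uniquely x B p + z A q + A B M with
  0 <= x < A and 0 <= z < B, and its denumerant is the number of pairs (i, j) with
  p i + q j <= M. Hence the generalized Frobenius number at s is a constant plus A B (V_s - 1),
  where V_0 <= V_1 <= ... are the values of p i + q j in increasing order.

  Here (p, q) is (h, 2h + 3) or (2h + 1, h + 2), so one generator is nearly twice the other.
  Collecting the pairs by their weight w, which is i + 2j or 2i + j respectively, gives blocks of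
  w div 2 + 1 values in arithmetic progression with difference 3, and the bound on n ensures that
  the relevant blocks do not overlap. The partial sums of the block sizes are the squares and the
  pronic numbers, so the step from V_s to V_(s+1) is 3 unless s + 1 is one of these, when it is
  the gap between two consecutive blocks.
*)

theory Submission
  imports Defs "HOL-Number_Theory.Cong"
begin

section \<open>Denumerants and Frobenius numbers of triples
  \<open>[B * p, A * B, A * q]\<close>\<close>

lemma finite_pairs_le:
  fixes p q :: nat and M :: int
  assumes "p > 0" "q > 0"
  shows "finite {(i, j). int (p * i + q * j) \<le> M}"
proof (rule finite_subset)
  show "{(i, j). int (p * i + q * j) \<le> M} \<subseteq> {..nat M} \<times> {..nat M}"
  proof -
    have "i \<le> nat M \<and> j \<le> nat M" if "int (p * i + q * j) \<le> M" for i j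
    proof -
      have "i \<le> p * i" "j \<le> q * j" using assms by simp_all
      then show ?thesis using that by linarith
    qed
    then show ?thesis by auto
  qed
qed simp

text \<open>Modulo \<open>A\<close> only the first term of the equation survives and
  \<open>B * p\<close> is a unit, so the first unknown is \<open>x + A * i\<close>; likewise the
  third is \<open>z + B * j\<close> modulo \<open>B\<close>. The middle unknown is then
  \<open>M - (p * i + q * j)\<close>, and its non-negativity is the condition being counted.\<close>

lemma denumerant_eq_card_pairs:
  fixes A B p q x z :: nat and M :: int
  assumes AB: "coprime A B" "coprime A p" "coprime B q" and x: "x < A" and z: "z < B"
  shows "denumerant (int (x * (B * p)) + int (z * (A * q)) + int (A * B) * M) [B * p, A * B, A * q]
       = card {(i, j). int (p * i + q * j) \<le> M}"
proof -
  define m where "m = int (x * (B * p)) + int (z * (A * q)) + int (A * B) * M"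
  define X where "X = {xs :: nat list. length xs = length [B * p, A * B, A * q] \<and>
      int (\<Sum>i<length [B * p, A * B, A * q]. [B * p, A * B, A * q] ! i * xs ! i) = m}"
  \<comment> \<open>On the domain the argument of \<open>nat\<close> is non-negative, so no
    truncation occurs.\<close>
  define f where "f = (\<lambda>(i, j). [x + A * i, nat (M - int (p * i + q * j)), z + B * j])"
  have pos: "A > 0" "B > 0" using x z by auto
  have sum3: "(\<Sum>i<length [B * p, A * B, A * q]. [B * p, A * B, A * q] ! i * xs ! i)
      = B * p * xs ! 0 + A * B * xs ! 1 + A * q * xs ! 2" for xs :: "nat list"
    by (simp add: numeral_3_eq_3 numeral_2_eq_2)
  have "bij_betw f {(i, j). int (p * i + q * j) \<le> M} X"
  proof (rule bij_betw_imageI)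
    show "inj_on f {(i, j). int (p * i + q * j) \<le> M}"
      using pos by (auto simp: inj_on_def f_def)
    show "f ` {(i, j). int (p * i + q * j) \<le> M} = X"
    proof
      show "f ` {(i, j). int (p * i + q * j) \<le> M} \<subseteq> X"
        unfolding X_def sum3 by (auto simp: f_def m_def algebra_simps)
      show "X \<subseteq> f ` {(i, j). int (p * i + q * j) \<le> M}"
      proof
        fix xs assume "xs \<in> X"
        then have len: "length xs = 3"
          and "int (B * p * xs ! 0 + A * B * xs ! 1 + A * q * xs ! 2) = m"
          unfolding X_def sum3 by auto
        moreover obtain a b c where xs: "xs = [a, b, c]"
          using len by (auto simp: numeral_3_eq_3 length_Suc_conv)
        ultimately have eq: "int (B * p * a + A * B * b + A * q * c) = m" by simp
        have "int A dvd int (B * p) * (int a - int x)"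
        proof -
          have "int (B * p) * (int a - int x) = int A * (int q * z + B * M - B * b - q * c)"
            using eq by (simp add: m_def algebra_simps)
          then show ?thesis by simp
        qed
        moreover have "coprime (int A) (int (B * p))" using AB by simp
        ultimately have "int A dvd int a - int x"
          using coprime_dvd_mult_right_iff by blast
        then have "[a = x] (mod A)"
          by (simp add: cong_iff_dvd_diff flip: cong_int_iff)
        then have "a mod A = x" using x by (simp add: cong_def)
        then have a: "a = x + A * (a div A)" by (metis add.commute mult_div_mod_eq)
        have "int B dvd int (A * q) * (int c - int z)"
        proof -
          have "int (A * q) * (int c - int z) = int B * (int p * x + A * M - A * b - p * a)"
            using eq by (simp add: m_def algebra_simps)
          then show ?thesis by simp
        qed
        moreover have "coprime (int B) (int (A * q))" using AB by (simp add: coprime_commute)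
        ultimately have "int B dvd int c - int z"
          using coprime_dvd_mult_right_iff by blast
        then have "[c = z] (mod B)"
          by (simp add: cong_iff_dvd_diff flip: cong_int_iff)
        then have "c mod B = z" using z by (simp add: cong_def)
        then have c: "c = z + B * (c div B)" by (metis add.commute mult_div_mod_eq)
        define i j where "i = a div A" and "j = c div B"
        have a': "a = x + A * i" and c': "c = z + B * j" using a c by (simp_all add: i_def j_def)
        \<comment> \<open>The contributions of \<open>x\<close> and \<open>z\<close> cancel and
          every remaining term has the factor \<open>A * B\<close>; dividing by it exhibits
          \<open>b\<close> as the slack in the inequality.\<close>
        have "int (A * B) * (int b + int (p * i + q * j)) = int (A * B) * M"
          using eq unfolding a' c' by (simp add: m_def algebra_simps)
        then have M: "int b + int (p * i + q * j) = M" using pos by simp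
        then have "xs = f (i, j)" unfolding f_def xs a' c' by simp
        moreover have "int (p * i + q * j) \<le> M" using M by linarith
        ultimately show "xs \<in> f ` {(i, j). int (p * i + q * j) \<le> M}" by blast
      qed
    qed
  qed
  then show ?thesis
    unfolding denumerant_def X_def m_def by (simp add: bij_betw_same_card)
qed

text \<open>Chinese remainder argument: inverses of \<open>B * p\<close> modulo \<open>A\<close> and
  of \<open>A * q\<close> modulo \<open>B\<close> yield \<open>x\<close> and \<open>z\<close>. The
  quotient \<open>M\<close> is an integer and may be negative.\<close>

lemma residue_decomposition:
  fixes A B p q :: nat and m :: int
  assumes "A > 0" "B > 0" "coprime A B" "coprime A p" "coprime B q"
  obtains x z :: nat and M :: int
  where "x < A" "z < B" "m = int (x * (B * p)) + int (z * (A * q)) + int (A * B) * M"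
proof -
  have "coprime (int (B * p)) (int A)" "coprime (int (A * q)) (int B)"
    using assms by (simp_all add: coprime_commute)
  then obtain u v where u: "[int (B * p) * u = 1] (mod int A)"
    and v: "[int (A * q) * v = 1] (mod int B)"
    using cong_solve_coprime_int by blast
  define x where "x = nat ((u * m) mod int A)"
  define z where "z = nat ((v * m) mod int B)"
  have x: "int x = (u * m) mod int A" and z: "int z = (v * m) mod int B"
    using assms by (simp_all add: x_def z_def)
  have "[int x = u * m] (mod int A)" "[int z = v * m] (mod int B)"
    unfolding x z by simp_all
  then have "[int (B * p) * int x = int (B * p) * (u * m)] (mod int A)"
    "[int (A * q) * int z = int (A * q) * (v * m)] (mod int B)"
    by (auto intro: cong_scalar_left)
  moreover have "[int (B * p) * u * m = 1 * m] (mod int A)"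
    "[int (A * q) * v * m = 1 * m] (mod int B)"
    using cong_scalar_right[OF u] cong_scalar_right[OF v] by blast+
  ultimately have "[int (B * p) * int x = m] (mod int A)" "[int (A * q) * int z = m] (mod int B)"
    by (metis cong_trans mult.assoc mult_1)+
  then have "int A dvd m - int (B * p) * int x" "int B dvd m - int (A * q) * int z"
    using cong_iff_dvd_diff cong_sym by blast+
  \<comment> \<open>A further multiple of \<open>A\<close>, respectively \<open>B\<close>, is
    subtracted so that both divisibilities concern the same number.\<close>
  then have "int A dvd m - int (B * p) * int x - int A * (int q * int z)"
    "int B dvd m - int (A * q) * int z - int B * (int p * int x)"
    by (simp_all add: dvd_diff)
  then have "int A dvd m - int (x * (B * p)) - int (z * (A * q))"
    "int B dvd m - int (x * (B * p)) - int (z * (A * q))"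
    by (simp_all add: algebra_simps)
  moreover have "coprime (int A) (int B)" using assms by simp
  ultimately have "int A * int B dvd m - int (x * (B * p)) - int (z * (A * q))"
    by (rule divides_mult)
  then obtain M where "m - int (x * (B * p)) - int (z * (A * q)) = int A * int B * M" ..
  then have "m = int (x * (B * p)) + int (z * (A * q)) + int (A * B) * M" by simp
  moreover have "x < A" "z < B" using assms x z by (metis of_nat_0_less_iff of_nat_less_iff pos_mod_bound)+
  ultimately show thesis using that by blast
qed

text \<open>The hypothesis \<open>card\<close> says that
  \<open>p * i\<^sub>0 + q * j\<^sub>0\<close> is the value with index \<open>s\<close>, counted
  from 0. The denumerant depends on \<open>M\<close> alone and stays at most \<open>s\<close>
  exactly while \<open>M\<close> is below that value; among the numbers with a given
  \<open>M\<close>, the largest has \<open>x = A - 1\<close> and \<open>z = B - 1\<close>.\<close>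

lemma gen_frobenius_eq:
  fixes A B p q i\<^sub>0 j\<^sub>0 s :: nat
  assumes pos: "A > 0" "B > 0" "p > 0" "q > 0"
    and cop: "coprime A B" "coprime A p" "coprime B q"
    and card: "card {(i, j). p * i + q * j < p * i\<^sub>0 + q * j\<^sub>0} = s"
  shows "gen_frobenius [B * p, A * B, A * q] s
       = int ((A - 1) * (B * p)) + int ((B - 1) * (A * q))
         + int (A * B) * (int (p * i\<^sub>0 + q * j\<^sub>0) - 1)"
proof -
  define V where "V = p * i\<^sub>0 + q * j\<^sub>0"
  define D where "D = {(i, j). int (p * i + q * j) \<le> int V - 1}"
  have fin: "finite D" unfolding D_def by (rule finite_pairs_le[OF pos(3,4)])
  have less: "card D = s"
    using card by (simp add: D_def V_def flip: of_nat_add of_nat_mult)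
  show ?thesis
    unfolding gen_frobenius_def V_def[symmetric]
  proof (rule Greatest_equality)
    show "denumerant (int ((A - 1) * (B * p)) + int ((B - 1) * (A * q)) + int (A * B) * (int V - 1))
      [B * p, A * B, A * q] \<le> s"
      using denumerant_eq_card_pairs[OF cop, of "A - 1" "B - 1" "int V - 1"] less pos by (simp add: D_def)
  next
    fix m assume m: "denumerant m [B * p, A * B, A * q] \<le> s"
    obtain x z M where xz: "x < A" "z < B"
      and m_eq: "m = int (x * (B * p)) + int (z * (A * q)) + int (A * B) * M"
      using residue_decomposition[OF pos(1,2) cop] by blast
    have le: "card {(i, j). int (p * i + q * j) \<le> M} \<le> s"
      using m denumerant_eq_card_pairs[OF cop xz, of M] by (simp add: m_eq)
    \<comment> \<open>Once \<open>M\<close> reaches \<open>V\<close>, the pair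
      \<open>(i\<^sub>0, j\<^sub>0)\<close> joins the \<open>s\<close> pairs in \<open>D\<close> and
      the count exceeds \<open>s\<close>.\<close>
    have "M \<le> int V - 1"
    proof (rule ccontr)
      assume "\<not> M \<le> int V - 1"
      then have "insert (i\<^sub>0, j\<^sub>0) D \<subseteq> {(i, j). int (p * i + q * j) \<le> M}"
        by (auto simp: D_def V_def)
      then have "card (insert (i\<^sub>0, j\<^sub>0) D) \<le> s"
        using card_mono[OF finite_pairs_le[OF pos(3,4)]] le order_trans by blast
      moreover have "(i\<^sub>0, j\<^sub>0) \<notin> D" by (simp add: D_def V_def)
      ultimately show False
        using less fin by simp
    qed
    moreover have "x * (B * p) \<le> (A - 1) * (B * p)" "z * (A * q) \<le> (B - 1) * (A * q)"
      using xz by (intro mult_le_mono1; simp)+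
    ultimately show "m \<le> int ((A - 1) * (B * p)) + int ((B - 1) * (A * q)) + int (A * B) * (int V - 1)"
      unfolding m_eq by (intro add_mono mult_left_mono) (simp_all only: of_nat_le_iff of_nat_0_le_iff)
  qed
qed

section \<open>Blocks of equal weight and their first indices\<close>

text \<open>The number of pairs of weight less than \<open>w\<close>, that is, the index of the first value of block \<open>w\<close>.\<close>

definition block_start :: "nat \<Rightarrow> nat" where
  "block_start w = ((w + 1) div 2) * ((w + 2) div 2)"

lemma block_start_Suc: "block_start (Suc w) = block_start w + w div 2 + 1"
proof (cases "even w")
  case True
  then obtain a where "w = 2 * a" by blast
  then show ?thesis by (simp add: block_start_def)
next
  case False
  then obtain a where "w = 2 * a + 1" using oddE by blast
  then show ?thesis by (simp add: block_start_def algebra_simps)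
qed

lemma strict_mono_block_start: "strict_mono block_start"
  by (simp add: strict_mono_Suc_iff block_start_Suc)

lemma block_start_square: "k \<ge> 1 \<Longrightarrow> block_start (2 * k - 1) = k\<^sup>2"
  by (auto simp: block_start_def power2_eq_square dest!: le_Suc_ex)

lemma block_start_pronic: "block_start (2 * k) = k * (k + 1)"
  by (simp add: block_start_def)

lemma block_start_eq_sum: "block_start w = (\<Sum>v<w. v div 2 + 1)"
  by (induction w) (simp_all add: block_start_Suc, simp add: block_start_def)

text \<open>Odd arguments of \<open>block_start\<close> give the squares and even ones the pronic
  numbers; the argument 0 is left out because \<open>k\<close> starts at 1.\<close>

lemma BB_eq: "BB = block_start ` {1..}"
proof
  show "BB \<subseteq> block_start ` {1..}"
  proof
    fix m assume "m \<in> BB"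
    then obtain k where "k \<ge> 1" "m = k\<^sup>2 \<or> m = k * (k + 1)"
      unfolding BB_def by blast
    then have "k \<ge> 1" "m = block_start (2 * k - 1) \<or> m = block_start (2 * k)"
      using block_start_square[of k] block_start_pronic[of k] by simp_all
    then show "m \<in> block_start ` {1..}" by auto
  qed
  show "block_start ` {1..} \<subseteq> BB"
  proof clarify
    fix w :: nat assume "w \<ge> 1"
    show "block_start w \<in> BB"
    proof (cases "even w")
      case True
      then obtain a where "w = 2 * a" by blast
      then show ?thesis using \<open>w \<ge> 1\<close> unfolding BB_def by (auto simp: block_start_pronic)
    next
      case False
      then obtain a where "w = 2 * Suc a - 1" by (auto elim: oddE)
      then show ?thesis unfolding BB_def using block_start_square[of "Suc a"] by fastforce
    qed
  qed
qed

text \<open>Here \<open>w\<close> is the block containing index \<open>s\<close> and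
  \<open>r\<close> the position inside it; after the last position \<open>w div 2\<close> comes
  position 0 of the next block.\<close>

lemma block_decomposition:
  obtains w r where "s = block_start w + r" "r \<le> w div 2"
proof -
  have "\<exists>w r. s = block_start w + r \<and> r \<le> w div 2"
  proof (induction s)
    case 0
    show ?case by (intro exI[of _ 0]) (simp add: block_start_def)
  next
    case (Suc s)
    then obtain w r where wr: "s = block_start w + r" "r \<le> w div 2" by blast
    show ?case
    proof (cases "r = w div 2")
      case True
      then show ?thesis using wr by (intro exI[of _ "Suc w"] exI[of _ 0]) (simp add: block_start_Suc)
    next
      case False
      then show ?thesis using wr by (intro exI[of _ w] exI[of _ "Suc r"]) simp
    qed
  qed
  then show thesis using that by blast
qed

text \<open>Such an index lies strictly between two consecutive values of the strictly increasing
  \<open>block_start\<close>.\<close>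

lemma inside_block_notin_BB:
  assumes "0 < r" "r \<le> w div 2"
  shows "block_start w + r \<notin> BB"
proof
  assume "block_start w + r \<in> BB"
  then obtain v where v: "block_start w + r = block_start v" unfolding BB_eq by auto
  then have "block_start w < block_start v" "block_start v < block_start (Suc w)"
    using assms by (simp_all add: block_start_Suc)
  then show False
    using strict_mono_less[OF strict_mono_block_start] by (metis less_Suc_eq_le not_less)
qed

text \<open>These are the lexicographic predecessors of \<open>(w, r)\<close>: all blocks before
  \<open>w\<close>, then \<open>r\<close> positions of block \<open>w\<close>. Both parities of
  \<open>n\<close> are reduced to this count.\<close>

lemma card_initial_segment:
  "card {(w', r'). r' \<le> w' div 2 \<and> (w' < w \<or> w' = w \<and> r' < r)} = block_start w + r"
  if "r \<le> w div 2"
proof -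
  have "{(w', r'). r' \<le> w' div 2 \<and> (w' < w \<or> w' = w \<and> r' < r)}
      = (SIGMA w':{..<w}. {..w' div 2}) \<union> {w} \<times> {..<r}"
    using that by auto
  moreover have "card \<dots> = card (SIGMA w':{..<w}. {..w' div 2}) + card ({w} \<times> {..<r})"
    by (rule card_Un_disjoint) auto
  ultimately show ?thesis by (simp add: block_start_eq_sum card_cartesian_product)
qed

section \<open>Order of the values \<open>p * i + q * j\<close> by weight and position\<close>

text \<open>The value is \<open>h * (i + 2 * j) + 3 * j\<close>, so the weight decides the order and
  \<open>j\<close> orders a block, provided \<open>3 * j\<close> does not bridge a gap of
  \<open>h\<close>. The bound \<open>w\<close> keeps lower blocks below block \<open>w\<close>;
  \<open>3 * r \<le> h\<close> keeps higher blocks from falling below the target value.\<close>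

lemma card_pairs_even:
  fixes h w r :: nat
  assumes r: "r \<le> w div 2" "3 * r \<le> h" and w: "3 * ((w + 1) div 2) < h + 3"
  shows "card {(i, j). h * i + (2 * h + 3) * j < h * w + 3 * r} = block_start w + r"
proof -
  have iff: "h * i + (2 * h + 3) * j < h * w + 3 * r
      \<longleftrightarrow> i + 2 * j < w \<or> i + 2 * j = w \<and> j < r" (is "?l \<longleftrightarrow> ?r") for i j
  proof -
    have val: "h * i + (2 * h + 3) * j = h * (i + 2 * j) + 3 * j" by (simp add: algebra_simps)
    consider "i + 2 * j < w" | "i + 2 * j = w" | "w < i + 2 * j" by linarith
    then show ?thesis
    proof cases
      case 1
      then obtain d where d: "w = i + 2 * j + 1 + d" by (metis Suc_eq_plus1 add.assoc add.commute less_iff_Suc_add)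
      have "j + 1 \<le> (w + 1) div 2" using d by simp
      then have "3 * j < h" using w by linarith
      moreover have "h * w = h * (i + 2 * j) + h + h * d" by (simp add: d algebra_simps)
      ultimately show ?thesis using 1 unfolding val by simp
    next
      case 2
      then show ?thesis unfolding val by auto
    next
      case 3
      then obtain d where d: "i + 2 * j = w + 1 + d" by (metis Suc_eq_plus1 add.assoc add.commute less_iff_Suc_add)
      have "h * (i + 2 * j) = h * w + h + h * d" unfolding d by (simp add: algebra_simps)
      then show ?thesis using 3 r unfolding val by simp
    qed
  qed
  \<comment> \<open>The position is \<open>j\<close>; the bound \<open>r' \<le> w' div 2\<close> is
    what makes \<open>i = w' - 2 * r'\<close> a genuine difference.\<close>
  have "bij_betw (\<lambda>(i, j). (i + 2 * j, j))
      {(i, j). i + 2 * j < w \<or> i + 2 * j = w \<and> j < r}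
      {(w', r'). r' \<le> w' div 2 \<and> (w' < w \<or> w' = w \<and> r' < r)}"
    by (rule bij_betw_byWitness[where f' = "\<lambda>(w', r'). (w' - 2 * r', r')"]) auto
  then show ?thesis unfolding iff using card_initial_segment[OF r(1)] bij_betw_same_card by fastforce
qed

text \<open>The value is \<open>(h + 2) * (j + 2 * i) - 3 * i\<close>, so within a block it grows as
  \<open>i\<close> falls. The parity of \<open>j\<close> is that of the weight, hence the position
  is \<open>j div 2\<close>. Passing from an odd weight to the next even one admits one more
  \<open>i\<close>, which lowers the start of the next block by 3; this is the reason for the extra
  bound when \<open>w\<close> is odd.\<close>

lemma card_pairs_odd:
  fixes h w r :: nat
  assumes r: "r \<le> w div 2" "odd w \<Longrightarrow> 3 * (r + 1) \<le> h + 2"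
    and w: "3 * (w div 2) < h + 2" and h: "h \<ge> 1"
  shows "card {(i, j). (2 * h + 1) * i + (h + 2) * j < (2 * h + 1) * (w div 2 - r) + (h + 2) * (w mod 2 + 2 * r)}
    = block_start w + r"
proof -
  have iff: "(2 * h + 1) * i + (h + 2) * j < (2 * h + 1) * (w div 2 - r) + (h + 2) * (w mod 2 + 2 * r)
      \<longleftrightarrow> j + 2 * i < w \<or> j + 2 * i = w \<and> j div 2 < r" (is "?l \<longleftrightarrow> ?r") for i j
  proof -
    \<comment> \<open>The term \<open>3 * a\<close> stands on the left to avoid truncated
      subtraction.\<close>
    have val: "(2 * h + 1) * a + (h + 2) * b + 3 * a = (h + 2) * (b + 2 * a)" for a b
      by (simp add: algebra_simps)
    \<comment> \<open>The target pair has weight \<open>w\<close> and position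
      \<open>r\<close>.\<close>
    have "w mod 2 + 2 * r + 2 * (w div 2 - r) = w" using r by presburger
    then have V: "(2 * h + 1) * (w div 2 - r) + (h + 2) * (w mod 2 + 2 * r) + 3 * (w div 2 - r) = (h + 2) * w"
      unfolding val by (rule arg_cong)
    note I = val[of i j]
    consider "j + 2 * i < w" | "j + 2 * i = w" | "w < j + 2 * i" by linarith
    then show ?thesis
    proof cases
      case 1
      then obtain d where d: "w = j + 2 * i + 1 + d" by (metis Suc_eq_plus1 add.assoc add.commute less_iff_Suc_add)
      have "(h + 2) * w = (h + 2) * (j + 2 * i) + (h + 2) + (h + 2) * d" by (simp add: d algebra_simps)
      then have ?l using V I w by linarith
      then show ?thesis using 1 by simp
    next
      case 2
      then have "w div 2 = j div 2 + i" by presburger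
      then have "w div 2 - r < i \<longleftrightarrow> j div 2 < r" using r(1) by linarith
      moreover have "?l \<longleftrightarrow> w div 2 - r < i" using V I[unfolded 2] by linarith
      ultimately show ?thesis using 2 by simp
    next
      case 3
      then obtain d where d: "j + 2 * i = w + 1 + d" by (metis Suc_eq_plus1 add.assoc add.commute less_iff_Suc_add)
      have "(h + 2) * (j + 2 * i) = (h + 2) * w + (h + 2) + (h + 2) * d" unfolding d by (simp add: algebra_simps)
      \<comment> \<open>With \<open>d\<close> further weights the main term grows by
        \<open>(h + 2) * d\<close>, while the growth of \<open>3 * i\<close> they permit is at most
        \<open>3 * d\<close>.\<close>
      moreover have "(h + 2) * d \<ge> 3 * d" using h by (intro mult_le_mono1) simp
      moreover have "3 * i + 3 * r \<le> h + 2 + 3 * d + 3 * (w div 2)"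
      proof (cases "odd w")
        case True
        then have "2 * (w div 2) + 1 = w" by presburger
        then have "i \<le> w div 2 + 1 + d" using d by linarith
        then have "3 * i \<le> 3 * (w div 2) + 3 + 3 * d" by simp
        then show ?thesis using r(2)[OF True] by simp
      next
        case False
        then have "2 * (w div 2) = w" by presburger
        then have "i \<le> w div 2 + d" using d by linarith
        then show ?thesis using r w by linarith
      qed
      ultimately have "\<not> ?l" using V I r(1) by linarith
      then show ?thesis using 3 by simp
    qed
  qed
  have "bij_betw (\<lambda>(i, j). (j + 2 * i, j div 2))
      {(i, j). j + 2 * i < w \<or> j + 2 * i = w \<and> j div 2 < r}
      {(w', r'). r' \<le> w' div 2 \<and> (w' < w \<or> w' = w \<and> r' < r)}"
  proof (rule bij_betw_byWitness[where f' = "\<lambda>(w', r'). (w' div 2 - r', w' mod 2 + 2 * r')"])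
    have width: "w' mod 2 + 2 * r' + 2 * (w' div 2 - r') = w'" if "r' \<le> w' div 2" for w' r' :: nat
      using that by presburger
    have half: "(w' mod 2 + 2 * r') div 2 = r'" for w' r' :: nat
      by presburger
    show "\<forall>a\<in>{(w', r'). r' \<le> w' div 2 \<and> (w' < w \<or> w' = w \<and> r' < r)}.
        (\<lambda>(i, j). (j + 2 * i, j div 2)) ((\<lambda>(w', r'). (w' div 2 - r', w' mod 2 + 2 * r')) a) = a"
      by (auto simp only: split_paired_all mem_Collect_eq case_prod_conv width half)
    show "(\<lambda>(w', r'). (w' div 2 - r', w' mod 2 + 2 * r'))
        ` {(w', r'). r' \<le> w' div 2 \<and> (w' < w \<or> w' = w \<and> r' < r)}
      \<subseteq> {(i, j). j + 2 * i < w \<or> j + 2 * i = w \<and> j div 2 < r}"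
      by (auto simp only: split_paired_all mem_Collect_eq case_prod_conv width half)
  qed auto
  then show ?thesis unfolding iff using card_initial_segment[OF r(1)] bij_betw_same_card by fastforce
qed

section \<open>Extracting bounds from \<open>N_even\<close> and \<open>N_odd\<close>\<close>

lemma N_even_lower: "c\<^sup>2 \<le> r + 1 \<Longrightarrow> 6 * int c - 6 \<le> N_even r"
proof -
  assume "c\<^sup>2 \<le> r + 1"
  then have "(real c)\<^sup>2 \<le> real r + 1" by (metis of_nat_1 of_nat_add of_nat_le_iff of_nat_power)
  then have "real c \<le> sqrt (real r + 1)" by (rule real_le_rsqrt)
  then have "int c \<le> \<lfloor>sqrt (real r + 1)\<rfloor>" by (simp add: le_floor_iff)
  then show ?thesis by (simp add: N_even_def)
qed

text \<open>Multiplying by 4 and completing the square turns the hypothesis into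
  \<open>(2 * c + 1)\<^sup>2 \<le> 4 * r + 5\<close>.\<close>

lemma N_odd_lower: "c * (c + 1) \<le> r + 1 \<Longrightarrow> 6 * int c - 3 \<le> N_odd r"
proof -
  assume "c * (c + 1) \<le> r + 1"
  then have "real c * (real c + 1) \<le> real r + 1" by (metis of_nat_1 of_nat_add of_nat_le_iff of_nat_mult)
  then have "(2 * real c + 1)\<^sup>2 \<le> 4 * real r + 5" by (simp add: power2_eq_square algebra_simps)
  then have "2 * real c + 1 \<le> sqrt (4 * real r + 5)" by (rule real_le_rsqrt)
  then have "int c \<le> \<lfloor>(sqrt (4 * real r + 5) - 1) / 2\<rfloor>" by (simp add: le_floor_iff)
  then show ?thesis by (simp add: N_odd_def)
qed

section \<open>Explicit Frobenius numbers for triangular triples\<close>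

text \<open>Instance \<open>A = h + 1\<close>, \<open>B = 2 * h + 1\<close>, \<open>p = h\<close>,
  \<open>q = 2 * h + 3\<close> of \<open>gen_frobenius_eq\<close>, with the pair
  \<open>(w - 2 * r, r)\<close>.\<close>

lemma triangular_frobenius_even:
  assumes h: "h > 0" and r: "r \<le> w div 2" and n: "int (2 * h) > N_even (block_start w + r)"
  shows "triangular_frobenius (2 * h) (block_start w + r)
    = int (h * ((2 * h + 1) * h)) + int (2 * h * ((h + 1) * (2 * h + 3)))
      + int ((h + 1) * (2 * h + 1)) * (int (h * w + 3 * r) - 1)"
proof -
  define u where "u = (w + 1) div 2"
  have "u * u \<le> block_start w" unfolding block_start_def u_def by (intro mult_le_mono) auto
  then have "u\<^sup>2 \<le> block_start w + r + 1" by (simp add: power2_eq_square)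
  then have w: "3 * ((w + 1) div 2) < h + 3" using N_even_lower n unfolding u_def by fastforce
  \<comment> \<open>Adding \<open>r + 1\<close> to this bound gives \<open>(r + 1)\<^sup>2\<close>,
    so \<open>r + 1\<close> serves as the witness for \<open>N_even_lower\<close>.\<close>
  have "r * (r + 1) \<le> block_start w" unfolding block_start_def using r by (intro mult_le_mono) auto
  then have "(r + 1)\<^sup>2 \<le> block_start w + r + 1" by (simp add: power2_eq_square)
  then have r': "3 * r \<le> h" using N_even_lower n by fastforce
  have V: "h * (w - 2 * r) + (2 * h + 3) * r = h * w + 3 * r"
  proof -
    have "h * (w - 2 * r) + h * (2 * r) = h * w" using r by (simp flip: distrib_left)
    then show ?thesis by (simp add: algebra_simps)
  qed
  have "coprime (h + 1) (2 * h + 1)" "coprime (h + 1) h" "coprime (2 * h + 1) (2 * h + 3)"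
  proof -
    show "coprime (h + 1) (2 * h + 1)"
    proof (rule coprimeI)
      fix c :: nat assume "c dvd h + 1" "c dvd 2 * h + 1"
      then have "c dvd 2 * (h + 1) - (2 * h + 1)" using dvd_diff_nat dvd_mult by blast
      then show "is_unit c" by simp
    qed
    show "coprime (h + 1) h" by simp
    show "coprime (2 * h + 1) (2 * h + 3)"
    proof (rule coprimeI)
      fix c :: nat assume c: "c dvd 2 * h + 1" "c dvd 2 * h + 3"
      then have "c dvd (2 * h + 3) - (2 * h + 1)" using dvd_diff_nat by blast
      then have "c dvd 2" by simp
      moreover have "coprime 2 (2 * h + 1)" by simp
      ultimately show "is_unit c" using c(1) by (metis coprime_common_divisor)
    qed
  qed
  from gen_frobenius_eq[OF _ _ h _ this, of "w - 2 * r" r "block_start w + r", unfolded V,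
      OF _ _ _ card_pairs_even[OF r r' w]]
  have "gen_frobenius [(2 * h + 1) * h, (h + 1) * (2 * h + 1), (h + 1) * (2 * h + 3)] (block_start w + r)
    = int (h * ((2 * h + 1) * h)) + int (2 * h * ((h + 1) * (2 * h + 3)))
      + int ((h + 1) * (2 * h + 1)) * (int (h * w + 3 * r) - 1)"
    by simp
  moreover have "triangular (2 * h) = (2 * h + 1) * h" by (simp add: triangular_def)
  moreover have "triangular (2 * h + 1) = (h + 1) * (2 * h + 1)"
    unfolding triangular_def by (simp add: algebra_simps)
  moreover have "triangular (2 * h + 2) = (h + 1) * (2 * h + 3)"
  proof -
    have "(2 * h + 2) * (2 * h + 2 + 1) = 2 * ((h + 1) * (2 * h + 3))" by (simp add: algebra_simps)
    then show ?thesis unfolding triangular_def by simp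
  qed
  ultimately show ?thesis by simp
qed

text \<open>Instance \<open>A = 2 * h + 3\<close>, \<open>B = h + 1\<close>,
  \<open>p = 2 * h + 1\<close>, \<open>q = h + 2\<close> of \<open>gen_frobenius_eq\<close>, with
  the pair \<open>(w div 2 - r, w mod 2 + 2 * r)\<close>.\<close>

lemma triangular_frobenius_odd:
  assumes h: "h > 0" and r: "r \<le> w div 2" and n: "int (2 * h + 1) > N_odd (block_start w + r)"
  shows "triangular_frobenius (2 * h + 1) (block_start w + r)
    = int ((2 * h + 2) * ((h + 1) * (2 * h + 1))) + int (h * ((2 * h + 3) * (h + 2)))
      + int ((2 * h + 3) * (h + 1)) * (int (h + 2) * int w - 3 * int (w div 2) + 3 * int r - 1)"
proof -
  define u where "u = w div 2"
  have ur: "r \<le> u" using r by (simp add: u_def)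
  have u: "u * (u + 1) \<le> block_start w" unfolding block_start_def u_def by (intro mult_le_mono) auto
  then have "u * (u + 1) \<le> block_start w + r + 1" by simp
  then have w: "3 * (w div 2) < h + 2" using N_odd_lower n unfolding u_def by fastforce
  have r': "3 * (r + 1) \<le> h + 2" if "odd w"
  proof -
    \<comment> \<open>For odd \<open>w\<close> both factors of \<open>block_start w\<close> equal
      \<open>u + 1\<close>. Adding \<open>r + 1\<close> to \<open>(r + 1)\<^sup>2\<close> then gives
      the pronic number needed by \<open>N_odd_lower\<close>.\<close>
    have "(u + 1) * (u + 1) \<le> block_start w"
      unfolding block_start_def u_def using that by (intro mult_le_mono) presburger+
    moreover have "(r + 1) * (r + 1) \<le> (u + 1) * (u + 1)" using ur by (intro mult_le_mono) auto
    ultimately have "(r + 1) * (r + 1 + 1) \<le> block_start w + r + 1" by simp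
    then show ?thesis using N_odd_lower n by fastforce
  qed
  define V where "V = (2 * h + 1) * (w div 2 - r) + (h + 2) * (w mod 2 + 2 * r)"
  have V: "int V = int (h + 2) * int w - 3 * int (w div 2) + 3 * int r"
  proof -
    define e where "e = w mod 2"
    obtain t where t: "w div 2 = r + t" using le_Suc_ex[OF r] by blast
    then have "w = 2 * (r + t) + e" unfolding e_def by presburger
    then have "int w = 2 * (int r + int t) + int e" by simp
    then show ?thesis unfolding V_def t e_def[symmetric] by (simp add: algebra_simps)
  qed
  have c: "coprime (2 * h + 3) (h + 1)" "coprime (2 * h + 3) (2 * h + 1)" "coprime (h + 1) (h + 2)"
  proof -
    show "coprime (2 * h + 3) (h + 1)"
    proof (rule coprimeI)
      fix c :: nat assume "c dvd 2 * h + 3" "c dvd h + 1"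
      then have "c dvd (2 * h + 3) - 2 * (h + 1)" using dvd_diff_nat dvd_mult by blast
      then show "is_unit c" by simp
    qed
    show "coprime (2 * h + 3) (2 * h + 1)"
    proof (rule coprimeI)
      fix c :: nat assume c: "c dvd 2 * h + 3" "c dvd 2 * h + 1"
      then have "c dvd (2 * h + 3) - (2 * h + 1)" using dvd_diff_nat by blast
      then have "c dvd 2" by simp
      moreover have "coprime 2 (2 * h + 1)" by simp
      ultimately show "is_unit c" using c(2) by (metis coprime_common_divisor)
    qed
    show "coprime (h + 1) (h + 2)" using coprime_Suc_right_nat[of "h + 1"] by simp
  qed
  have "h \<ge> 1" using h by simp
  note card = card_pairs_odd[OF r r' w this]
  have pos: "2 * h + 3 > 0" "h + 1 > 0" "2 * h + 1 > 0" "h + 2 > 0" by simp_all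
  have pred: "2 * h + 3 - 1 = 2 * h + 2" "h + 1 - 1 = h" by simp_all
  have "gen_frobenius [(h + 1) * (2 * h + 1), (2 * h + 3) * (h + 1), (2 * h + 3) * (h + 2)] (block_start w + r)
    = int ((2 * h + 2) * ((h + 1) * (2 * h + 1))) + int (h * ((2 * h + 3) * (h + 2)))
      + int ((2 * h + 3) * (h + 1)) * (int V - 1)"
    using gen_frobenius_eq[OF pos c card] unfolding pred V_def .
  moreover have "triangular (2 * h + 1) = (h + 1) * (2 * h + 1)"
    unfolding triangular_def by (simp add: algebra_simps)
  moreover have "triangular (2 * h + 1 + 1) = (2 * h + 3) * (h + 1)"
  proof -
    have "(2 * h + 1 + 1) * (2 * h + 1 + 1 + 1) = 2 * ((2 * h + 3) * (h + 1))" by (simp add: algebra_simps)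
    then show ?thesis unfolding triangular_def by (simp only: nonzero_mult_div_cancel_left zero_neq_numeral[symmetric] not_False_eq_True)
  qed
  moreover have "triangular (2 * h + 1 + 2) = (2 * h + 3) * (h + 2)"
  proof -
    have "(2 * h + 1 + 2) * (2 * h + 1 + 2 + 1) = 2 * ((2 * h + 3) * (h + 2))" by (simp add: algebra_simps)
    then show ?thesis unfolding triangular_def by (simp only: nonzero_mult_div_cancel_left zero_neq_numeral[symmetric] not_False_eq_True)
  qed
  ultimately show ?thesis unfolding V by (simp only:)
qed

section \<open>Differences of consecutive Frobenius numbers\<close>

lemma N_even_mono: "r \<le> r' \<Longrightarrow> N_even r \<le> N_even r'"
  by (simp add: N_even_def floor_mono)

lemma N_odd_mono: "r \<le> r' \<Longrightarrow> N_odd r \<le> N_odd r'"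
  by (simp add: N_odd_def floor_mono divide_right_mono)

text \<open>Block \<open>w\<close> ends at \<open>h * w + 3 * (w div 2)\<close> and the next begins
  at \<open>h * (w + 1)\<close>; inside a block neighbours differ by 3.\<close>

lemma triangular_frobenius_even_step:
  assumes h: "h > 0" and r: "r \<le> w div 2" and n: "int (2 * h) > N_even (block_start w + r + 1)"
  shows "triangular_frobenius (2 * h) (block_start w + r + 1) - triangular_frobenius (2 * h) (block_start w + r)
    = (if r < w div 2 then 3 else int h - 3 * int (w div 2)) * int ((h + 1) * (2 * h + 1))"
proof -
  have n': "int (2 * h) > N_even (block_start w + r)"
    using n N_even_mono[of "block_start w + r" "block_start w + r + 1"] by simp
  note before = triangular_frobenius_even[OF h r n']
  show ?thesis
  proof (cases "r < w div 2")
    case True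
    have "triangular_frobenius (2 * h) (block_start w + r + 1)
      = int (h * ((2 * h + 1) * h)) + int (2 * h * ((h + 1) * (2 * h + 3)))
        + int ((h + 1) * (2 * h + 1)) * (int (h * w + 3 * (r + 1)) - 1)"
      using triangular_frobenius_even[OF h, of "r + 1" w] True n by simp
    then show ?thesis unfolding before using True by (simp add: algebra_simps)
  next
    case False
    then have r_eq: "r = w div 2" using r by simp
    have next_block: "block_start w + r + 1 = block_start (Suc w) + 0"
      unfolding r_eq by (simp add: block_start_Suc)
    have "triangular_frobenius (2 * h) (block_start w + r + 1)
      = int (h * ((2 * h + 1) * h)) + int (2 * h * ((h + 1) * (2 * h + 3)))
        + int ((h + 1) * (2 * h + 1)) * (int (h * Suc w + 3 * 0) - 1)"
      using n unfolding next_block by (intro triangular_frobenius_even[OF h]) simp_all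
    then show ?thesis unfolding before using False r_eq by (simp add: algebra_simps)
  qed
qed

text \<open>Block \<open>w\<close> ends at \<open>(h + 2) * w\<close>, where \<open>i = 0\<close>;
  the next begins at \<open>(h + 2) * (w + 1) - 3 * (Suc w div 2)\<close>.\<close>

lemma triangular_frobenius_odd_step:
  assumes h: "h > 0" and r: "r \<le> w div 2" and n: "int (2 * h + 1) > N_odd (block_start w + r + 1)"
  shows "triangular_frobenius (2 * h + 1) (block_start w + r + 1) - triangular_frobenius (2 * h + 1) (block_start w + r)
    = (if r < w div 2 then 3 else int h + 2 - 3 * int (Suc w div 2)) * int ((2 * h + 3) * (h + 1))"
proof -
  have n': "int (2 * h + 1) > N_odd (block_start w + r)"
    using n N_odd_mono[of "block_start w + r" "block_start w + r + 1"] by simp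
  note before = triangular_frobenius_odd[OF h r n']
  show ?thesis
  proof (cases "r < w div 2")
    case True
    have "triangular_frobenius (2 * h + 1) (block_start w + r + 1)
      = int ((2 * h + 2) * ((h + 1) * (2 * h + 1))) + int (h * ((2 * h + 3) * (h + 2)))
        + int ((2 * h + 3) * (h + 1)) * (int (h + 2) * int w - 3 * int (w div 2) + 3 * int (r + 1) - 1)"
      using triangular_frobenius_odd[OF h, of "r + 1" w] True n by simp
    then show ?thesis unfolding before using True by (simp add: algebra_simps)
  next
    case False
    then have r_eq: "r = w div 2" using r by simp
    have next_block: "block_start w + r + 1 = block_start (Suc w) + 0"
      unfolding r_eq by (simp add: block_start_Suc)
    have "triangular_frobenius (2 * h + 1) (block_start w + r + 1)
      = int ((2 * h + 2) * ((h + 1) * (2 * h + 1))) + int (h * ((2 * h + 3) * (h + 2)))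
        + int ((2 * h + 3) * (h + 1)) * (int (h + 2) * int (Suc w) - 3 * int (Suc w div 2) + 3 * int 0 - 1)"
      using n unfolding next_block by (intro triangular_frobenius_odd[OF h]) simp_all
    moreover have "int (w div 2) = int r" using r_eq by simp
    ultimately show ?thesis unfolding before using False by (simp add: algebra_simps)
  qed
qed

section \<open>Block boundaries expressed by squares and pronic numbers\<close>

theorem theorem1p2:
  fixes s n :: nat
  assumes "n > 0"
    and "even n \<Longrightarrow> int n > N_even (s + 1)"
    and "odd n \<Longrightarrow> int n > N_odd (s + 1)"
  shows "(s + 1 \<notin> BB \<longrightarrow>
            real_of_int (triangular_frobenius n (s + 1) - triangular_frobenius n s)
              = 6 * (real n + 1) * (real n + 2) / 4) \<and>
         (even n \<and> s + 1 \<in> BB \<longrightarrow>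
            (\<forall>k::nat. k \<ge> 1 \<and> (s + 1 = k\<^sup>2 \<or> s + 1 = k * (k + 1)) \<longrightarrow>
              real_of_int (triangular_frobenius n (s + 1) - triangular_frobenius n s)
                = (real n - 6 * real k + 6) * (real n + 1) * (real n + 2) / 4)) \<and>
         (odd n \<and> s + 1 \<in> BB \<longrightarrow>
            (\<forall>k::nat. k \<ge> 1 \<longrightarrow>
              (s + 1 = k\<^sup>2 \<longrightarrow>
                real_of_int (triangular_frobenius n (s + 1) - triangular_frobenius n s)
                  = (real n - 6 * real k + 9) * (real n + 1) * (real n + 2) / 4) \<and>
              (s + 1 = k * (k + 1) \<longrightarrow>
                real_of_int (triangular_frobenius n (s + 1) - triangular_frobenius n s)
                  = (real n - 6 * real k + 3) * (real n + 1) * (real n + 2) / 4)))"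
proof -
  obtain w r where s: "s = block_start w + r" and r: "r \<le> w div 2"
    using block_decomposition by blast
  \<comment> \<open>Membership in \<open>BB\<close> means that \<open>s\<close> is the last index of
    its block, so that \<open>s + 1\<close> starts block \<open>Suc w\<close>.\<close>
  have BB_iff: "s + 1 \<in> BB \<longleftrightarrow> \<not> r < w div 2"
  proof
    show "s + 1 \<in> BB \<Longrightarrow> \<not> r < w div 2"
      using inside_block_notin_BB[of "r + 1" w] by (auto simp: s)
    assume "\<not> r < w div 2"
    then have "s + 1 = block_start (Suc w)" using r by (simp add: s block_start_Suc)
    then show "s + 1 \<in> BB" unfolding BB_eq by simp
  qed
  have start: "s + 1 = block_start (Suc w)" if "s + 1 \<in> BB"
    using that r unfolding BB_iff by (simp add: s block_start_Suc)
  have square: "w = 2 * (k - 1)" if "s + 1 \<in> BB" "k \<ge> 1" "s + 1 = k\<^sup>2" for k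
  proof -
    have "block_start (Suc w) = block_start (2 * k - 1)"
      using start that block_start_square[of k] by simp
    then have "Suc w = 2 * k - 1" using strict_mono_eq[OF strict_mono_block_start] by blast
    then show ?thesis by simp
  qed
  have pronic: "w = 2 * (k - 1) + 1" if "s + 1 \<in> BB" "k \<ge> 1" "s + 1 = k * (k + 1)" for k
  proof -
    have "block_start (Suc w) = block_start (2 * k)"
      using start that by (simp add: block_start_pronic)
    then have "Suc w = 2 * k" using strict_mono_eq[OF strict_mono_block_start] by blast
    then show ?thesis using that by simp
  qed
  show ?thesis
  proof (cases "even n")
    case True
    then obtain h where nh: "n = 2 * h" by blast
    define g where "g = triangular_frobenius n (s + 1) - triangular_frobenius n s"
    have "g = (if r < w div 2 then 3 else int h - 3 * int (w div 2)) * int ((h + 1) * (2 * h + 1))"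
      unfolding g_def s nh
      by (rule triangular_frobenius_even_step) (use assms True r in \<open>simp_all add: nh s\<close>)
    then have g: "real_of_int g
      = (if r < w div 2 then 3 else real h - 3 * real (w div 2)) * ((real h + 1) * (2 * real h + 1))"
      by (simp split: if_split add: algebra_simps)
    \<comment> \<open>The square case has \<open>w = 2 * (k - 1)\<close> and the pronic case one
      more, so halving merges them and even \<open>n\<close> needs one formula.\<close>
    have "w div 2 = k - 1" if "s + 1 \<in> BB" "k \<ge> 1" "s + 1 = k\<^sup>2 \<or> s + 1 = k * (k + 1)" for k
      using square pronic that by fastforce
    then have sp: "real_of_int g = (real h - 3 * (real k - 1)) * ((real h + 1) * (2 * real h + 1))"
      if "s + 1 \<in> BB" "k \<ge> 1" "s + 1 = k\<^sup>2 \<or> s + 1 = k * (k + 1)" for k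
      using that g BB_iff by (simp add: of_nat_diff)
    show ?thesis
      unfolding g_def[symmetric]
    proof (intro conjI impI allI)
      assume "s + 1 \<notin> BB"
      then show "real_of_int g = 6 * (real n + 1) * (real n + 2) / 4"
        using g BB_iff by (simp add: nh field_simps)
    next
      fix k assume "even n \<and> s + 1 \<in> BB" "1 \<le> k \<and> (s + 1 = k\<^sup>2 \<or> s + 1 = k * (k + 1))"
      then show "real_of_int g = (real n - 6 * real k + 6) * (real n + 1) * (real n + 2) / 4"
        using sp[of k] by (simp add: nh field_simps)
    qed (use True in simp_all)
  next
    case False
    then obtain h where nh: "n = 2 * h + 1" using oddE by blast
    define g where "g = triangular_frobenius n (s + 1) - triangular_frobenius n s"
    \<comment> \<open>The witness \<open>c = 1\<close> gives \<open>N_odd (s + 1) \<ge> 3\<close>,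
      which excludes \<open>n = 1\<close>.\<close>
    have "h > 0"
    proof -
      have "6 * int 1 - 3 \<le> N_odd (s + 1)" by (rule N_odd_lower) simp
      then show ?thesis using assms(3) False nh by simp
    qed
    then have "g = (if r < w div 2 then 3 else int h + 2 - 3 * int (Suc w div 2)) * int ((2 * h + 3) * (h + 1))"
      unfolding g_def s nh
      by (rule triangular_frobenius_odd_step) (use assms False r in \<open>simp_all add: nh s\<close>)
    then have "real_of_int g = real_of_int
        ((if r < w div 2 then 3 else int h + 2 - 3 * int (Suc w div 2)) * int ((2 * h + 3) * (h + 1)))"
      by (rule arg_cong)
    then have g: "real_of_int g
      = (if r < w div 2 then 3 else real h + 2 - 3 * real (Suc w div 2)) * ((2 * real h + 3) * (real h + 1))"
      by (simp split: if_split add: algebra_simps)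
    \<comment> \<open>Here \<open>Suc w div 2\<close> occurs, which is \<open>k - 1\<close> for a
      square and \<open>k\<close> for a pronic number; hence two formulas for odd
      \<open>n\<close>.\<close>
    have sq: "real_of_int g = (real h + 2 - 3 * (real k - 1)) * ((2 * real h + 3) * (real h + 1))"
      if "s + 1 \<in> BB" "k \<ge> 1" "s + 1 = k\<^sup>2" for k
      using that g BB_iff square[OF that] by (simp add: of_nat_diff)
    have pr: "real_of_int g = (real h + 2 - 3 * real k) * ((2 * real h + 3) * (real h + 1))"
      if "s + 1 \<in> BB" "k \<ge> 1" "s + 1 = k * (k + 1)" for k
      using that g BB_iff pronic[OF that] by (simp add: of_nat_diff)
    show ?thesis
      unfolding g_def[symmetric]
    proof (intro conjI impI allI)
      assume "s + 1 \<notin> BB"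
      then show "real_of_int g = 6 * (real n + 1) * (real n + 2) / 4"
        \<comment> \<open>The factor \<open>(2 * h + 3) * (h + 1)\<close> is
          \<open>(n + 1) * (n + 2) / 2\<close>.\<close>
        using g BB_iff by (simp add: nh field_simps)
    next
      fix k assume "odd n \<and> s + 1 \<in> BB" "1 \<le> k" "s + 1 = k\<^sup>2"
      then show "real_of_int g = (real n - 6 * real k + 9) * (real n + 1) * (real n + 2) / 4"
        using sq[of k] by (simp add: nh field_simps)
    next
      fix k assume "odd n \<and> s + 1 \<in> BB" "1 \<le> k" "s + 1 = k * (k + 1)"
      then show "real_of_int g = (real n - 6 * real k + 3) * (real n + 1) * (real n + 2) / 4"
        using pr[of k] by (simp add: nh field_simps)
    qed (use False in simp_all)
  qed
qed

end
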